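(* Let $\mathcal{P}$ be any honest property of sequences. If $G$ is a graph containing two edge-disjoint spanning trees, then $\mathcal{P}\text{-}\mathrm{c}(G)\leq 2m(\mathcal{P})$. In particular, every $4$-connected graph $G$ satisfies $\mathcal{P}\text{-}\mathrm{c}(G)\leq 2m(\mathcal{P})$.
   Context: Graphs are simple and connected. A graph is $k$-connected if it cannot be disconnected by deleting $k-1$ vertices. A block of a sequence is a subsequence of consecutive terms. A property $\mathcal{P}$ of sequences (words) is called honest if: (i) if a sequence $S$ has property $\mathcal{P}$, then each nonempty block of $S$ also satisfies $\mathcal{P}$; (ii) if $S$ and $T$ are two sequences over disjoint alphabets (color sets) satisfying $\mathcal{P}$, then their concatenation $ST$ also satisfies $\mathcal{P}$; (iii) there exist arbitrarily long sequences over some finite alphabet satisfying property $\mathcal{P}$. For an honest property $\mathcal{P}$, $m(\mathcal{P})$ denotes the least possible constant in condition (iii), that is, the least size of a finite alphabet over which there exist arbitrarily long sequences satisfying $\mathcal{P}$. A $\mathcal{P}$-connected coloring of a graph $G$ is a coloring of the edges of $G$ such that every pair of distinct vertices is joined by a path whose color sequence (the sequence of colors of its consecutive edges) has property $\mathcal{P}$. $\mathcal{P}\text{-}\mathrm{c}(G)$ denotes the minimum number of colors needed for a $\mathcal{P}$-connected coloring of $G$.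
   Formalization: The property of sequences is additionally assumed to be invariant under injective renaming of colors (it depends only on the pattern of the word); for an arbitrary honest predicate on words over fixed colors the claim fails. *)

theory Defs
  imports
    "HOL-Library.Sublist"
    "HOL-Library.Extended_Nat"
    "HOL-Library.Infinite_Typeclass"
begin

section \<open>Properties of sequences\<close>

text \<open>
  Sequences are finite lists of colors. The colors form an infinite type, so that fresh colors are
  always available. A property of sequences speaks about the pattern of a sequence only:
  whether it holds does not depend on which colors play the roles of the letters.
\<close>

definition rename_invariant :: "('c list \<Rightarrow> bool) \<Rightarrow> bool" where
  "rename_invariant P \<longleftrightarrow> (\<forall>f S. inj_on f (set S) \<longrightarrow> (P (map f S) \<longleftrightarrow> P S))"

definition arbitrarily_long_over :: "('c list \<Rightarrow> bool) \<Rightarrow> 'c set \<Rightarrow> bool" where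
  "arbitrarily_long_over P A \<longleftrightarrow> (\<forall>n. \<exists>S. length S \<ge> n \<and> set S \<subseteq> A \<and> P S)"

definition honest :: "('c list \<Rightarrow> bool) \<Rightarrow> bool" where
  "honest P \<longleftrightarrow>
     (\<forall>S B. P S \<longrightarrow> sublist B S \<longrightarrow> B \<noteq> [] \<longrightarrow> P B) \<and>
     (\<forall>S T. P S \<longrightarrow> P T \<longrightarrow> set S \<inter> set T = {} \<longrightarrow> P (S @ T)) \<and>
     (\<exists>A. finite A \<and> arbitrarily_long_over P A)"

definition m_const :: "('c list \<Rightarrow> bool) \<Rightarrow> nat" where
  "m_const P = (LEAST k. \<exists>A. finite A \<and> card A = k \<and> arbitrarily_long_over P A)"


section \<open>Finite simple graphs\<close>

text \<open>A graph is given by its vertex set and its set of two-element edges.\<close>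

definition simple_graph :: "'v set \<Rightarrow> 'v set set \<Rightarrow> bool" where
  "simple_graph V E \<longleftrightarrow> finite V \<and> V \<noteq> {} \<and> (\<forall>e\<in>E. e \<subseteq> V \<and> card e = 2)"

definition path_between :: "'v set \<Rightarrow> 'v set set \<Rightarrow> 'v \<Rightarrow> 'v list \<Rightarrow> 'v \<Rightarrow> bool" where
  "path_between V E u p v \<longleftrightarrow>
     p \<noteq> [] \<and> hd p = u \<and> last p = v \<and> distinct p \<and> set p \<subseteq> V \<and>
     successively (\<lambda>x y. {x, y} \<in> E) p"

definition path_edges :: "'v list \<Rightarrow> 'v set list" where
  "path_edges p = map2 (\<lambda>x y. {x, y}) p (tl p)"

text \<open>The empty vertex set counts as connected here; graphs themselves are nonempty.\<close>

definition all_joined :: "'v set \<Rightarrow> 'v set set \<Rightarrow> bool" where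
  "all_joined V E \<longleftrightarrow> (\<forall>u\<in>V. \<forall>v\<in>V. \<exists>p. path_between V E u p v)"

definition connected_graph :: "'v set \<Rightarrow> 'v set set \<Rightarrow> bool" where
  "connected_graph V E \<longleftrightarrow> simple_graph V E \<and> all_joined V E"

definition is_cycle :: "'v set set \<Rightarrow> 'v list \<Rightarrow> bool" where
  "is_cycle E p \<longleftrightarrow>
     length p \<ge> 3 \<and> distinct p \<and> successively (\<lambda>x y. {x, y} \<in> E) p \<and> {last p, hd p} \<in> E"

definition is_tree :: "'v set \<Rightarrow> 'v set set \<Rightarrow> bool" where
  "is_tree V T \<longleftrightarrow> connected_graph V T \<and> (\<nexists>p. is_cycle T p)"

definition spanning_tree :: "'v set \<Rightarrow> 'v set set \<Rightarrow> 'v set set \<Rightarrow> bool" where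
  "spanning_tree V E T \<longleftrightarrow> T \<subseteq> E \<and> is_tree V T"

text \<open>
  No deletion of at most \<open>k - 1\<close> vertices disconnects the graph. There is no separate requirement
  of more than \<open>k\<close> vertices, so small complete graphs are included.
\<close>

definition k_connected :: "nat \<Rightarrow> 'v set \<Rightarrow> 'v set set \<Rightarrow> bool" where
  "k_connected k V E \<longleftrightarrow>
     simple_graph V E \<and>
     (\<forall>S. S \<subseteq> V \<longrightarrow> card S < k \<longrightarrow> all_joined (V - S) {e \<in> E. e \<subseteq> V - S})"


section \<open>Connected colorings\<close>

text \<open>
  The quantification is over ordered pairs: some path read from \<open>u\<close> to \<open>v\<close> and some path
  read from \<open>v\<close> to \<open>u\<close> have the property.
\<close>

definition connected_coloring ::
    "('c list \<Rightarrow> bool) \<Rightarrow> 'v set \<Rightarrow> 'v set set \<Rightarrow> ('v set \<Rightarrow> 'c) \<Rightarrow> bool" where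
  "connected_coloring P V E f \<longleftrightarrow>
     (\<forall>u\<in>V. \<forall>v\<in>V. u \<noteq> v \<longrightarrow>
        (\<exists>p. path_between V E u p v \<and> P (map f (path_edges p))))"

text \<open>
  The infimum over an empty set is \<open>\<infinity>\<close>, so a finite bound on this number entails that a
  suitable coloring exists; otherwise the infimum is attained.
\<close>

definition P_c :: "('c list \<Rightarrow> bool) \<Rightarrow> 'v set \<Rightarrow> 'v set set \<Rightarrow> enat" where
  "P_c P V E = (INF f \<in> {f. connected_coloring P V E f}. enat (card (f ` E)))"

end

theory Submission
  imports Defs "HOL-Library.Cardinality"
begin

text \<open>
  The coloring comes from two disjoint connected spanning sets of edges \<open>T1\<close> and \<open>T2\<close>.
  Fix a root \<open>r\<close> and one long sequence \<open>S\<close> with the property over a smallest alphabet,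
  together with a copy \<open>S'\<close> of it over fresh letters. Color \<open>T1\<close> by distance to \<open>r\<close> so that
  a shortest path climbing in \<open>T1\<close> to \<open>r\<close> reads a block of \<open>S\<close>, and color \<open>T2\<close> so that a
  shortest path descending from \<open>r\<close> reads a block of \<open>S'\<close>. To go from \<open>u\<close> to \<open>v\<close>, climb from
  \<open>u\<close> in \<open>T1\<close> until the descent from \<open>r\<close> to \<open>v\<close> in \<open>T2\<close> is met for the first time, and follow
  that descent from there. This is a path, and its colors form a block of \<open>S\<close> followed by a block of
  \<open>S'\<close>, so honesty applies. Every ordered pair is served by the same recipe, hence the
  property may distinguish a sequence from its reversal
  (\<open>coloring_from_two_connected_subgraphs\<close>).

  For a 4-connected graph the sets \<open>T1\<close>, \<open>T2\<close> have to be found. On at most five vertices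
  4-connectedness in the sense used here forces the graph to be complete, and one color is enough
  then; this matters, since complete graphs on two or three vertices have no two disjoint
  spanning trees. On more than four vertices every edge cut has at least four edges
  (\<open>cut_ge_connectivity\<close>), so for every partition of the vertices into \<open>r \<ge> 2\<close> classes at least
  \<open>2 r\<close> edges run between classes (\<open>comps_le_cross_edges\<close>). This is more than the \<open>2 (r - 1)\<close>
  edges that the theorem of Nash-Williams and Tutte (\<open>tree_packing\<close>) asks for. That theorem
  is proved by exchanging edges in a packing of disjoint forests that has the largest possible
  total size.
\<close>

section \<open>Reachability and components\<close>

definition adj :: "'v set set \<Rightarrow> ('v \<times> 'v) set" where
  "adj F = {(x, y). {x, y} \<in> F}"

definition reach :: "'v set set \<Rightarrow> ('v \<times> 'v) set" where
  "reach F = (adj F)\<^sup>*"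

definition comps :: "'v set \<Rightarrow> 'v set set \<Rightarrow> 'v set set" where
  "comps V F = (\<lambda>x. reach F `` {x}) ` V"

lemma reach_refl [simp]: "(x, x) \<in> reach F"
  by (simp add: reach_def)

lemma reach_trans: "(x, y) \<in> reach F \<Longrightarrow> (y, z) \<in> reach F \<Longrightarrow> (x, z) \<in> reach F"
  unfolding reach_def by (rule rtrancl_trans)

lemma reach_sym: "(x, y) \<in> reach F \<Longrightarrow> (y, x) \<in> reach F"
proof -
  have "sym (adj F)" by (auto simp: sym_def adj_def insert_commute)
  then have "sym (reach F)" unfolding reach_def by (rule sym_rtrancl)
  then show "(x, y) \<in> reach F \<Longrightarrow> (y, x) \<in> reach F" by (rule symD)
qed

lemma reach_edge: "{x, y} \<in> F \<Longrightarrow> (x, y) \<in> reach F"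
  by (auto simp: reach_def adj_def)

lemma reach_mono: "F \<subseteq> G \<Longrightarrow> reach F \<subseteq> reach G"
  unfolding reach_def by (rule rtrancl_mono) (auto simp: adj_def)

lemma reach_subset:
  assumes "\<And>x y. {x, y} \<in> F \<Longrightarrow> (x, y) \<in> reach G"
  shows "reach F \<subseteq> reach G"
proof -
  have "adj F \<subseteq> (adj G)\<^sup>*" using assms by (auto simp: adj_def reach_def)
  then show ?thesis unfolding reach_def by (rule rtrancl_subset_rtrancl)
qed

lemma reach_insert_redundant:
  assumes "(a, b) \<in> reach F"
  shows "reach (insert {a, b} F) = reach F"
proof
  show "reach (insert {a, b} F) \<subseteq> reach F"
    using assms reach_sym[OF assms]
    by (intro reach_subset) (auto simp: doubleton_eq_iff reach_edge)
qed (rule reach_mono, auto)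

lemma reach_closed:
  assumes "(x, y) \<in> reach F" "x \<in> X" "\<And>e. e \<in> F \<Longrightarrow> e \<inter> X \<noteq> {} \<Longrightarrow> e \<subseteq> X"
  shows "y \<in> X"
  using assms(1) unfolding reach_def
proof (induction rule: rtrancl_induct)
  case base then show ?case using assms(2) .
next
  case (step y z)
  then show ?case using assms(3)[of "{y, z}"] by (auto simp: adj_def)
qed

lemma reach_insertD:
  assumes "(x, y) \<in> reach (insert {a, b} F)"
  shows "(x, y) \<in> reach F \<or> (x, a) \<in> reach F \<and> (b, y) \<in> reach F
           \<or> (x, b) \<in> reach F \<and> (a, y) \<in> reach F"
  using assms unfolding reach_def[of "insert {a, b} F"]
proof (induction rule: rtrancl_induct)
  case base then show ?case by simp
next
  case (step y z)
  from step.hyps(2) consider "(y, z) \<in> reach F" | "y = a" "z = b" | "y = b" "z = a"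
    by (auto simp: adj_def doubleton_eq_iff reach_edge)
  then show ?case
  proof cases
    case 1
    then show ?thesis using step.IH by (meson reach_trans)
  next
    case 2
    then show ?thesis using step.IH by (meson reach_trans reach_sym reach_refl)
  next
    case 3
    then show ?thesis using step.IH by (meson reach_trans reach_sym reach_refl)
  qed
qed

text \<open>
  The exchange property of the graphic matroid: if \<open>ab\<close> is what connects \<open>u\<close> with \<open>v\<close>, then
  \<open>uv\<close> can stand in for \<open>ab\<close>.
\<close>

lemma reach_exchange:
  assumes "(u, v) \<in> reach (insert {a, b} F)" "(u, v) \<notin> reach F"
  shows "(a, b) \<in> reach (insert {u, v} F)"
proof -
  have mono: "reach F \<subseteq> reach (insert {u, v} F)" by (rule reach_mono) auto
  have uv: "(u, v) \<in> reach (insert {u, v} F)" by (rule reach_edge) simp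
  from reach_insertD[OF assms(1)] assms(2)
  consider "(u, a) \<in> reach F" "(b, v) \<in> reach F" | "(u, b) \<in> reach F" "(a, v) \<in> reach F"
    by blast
  then show ?thesis
    by cases (meson mono uv subsetD reach_trans reach_sym)+
qed

lemma reach_class_eq_iff: "reach F `` {x} = reach F `` {y} \<longleftrightarrow> (x, y) \<in> reach F"
  by (auto dest: reach_trans reach_sym)

lemma finite_comps: "finite V \<Longrightarrow> finite (comps V F)"
  by (simp add: comps_def)

lemma card_comps_empty: "card (comps V {}) = card V"
proof -
  have "reach {} = (Id :: ('a \<times> 'a) set)" by (simp add: reach_def adj_def)
  then have "comps V {} = (\<lambda>x. {x}) ` V" by (simp add: comps_def)
  then show ?thesis by (simp add: card_image)
qed

lemma card_comps_pos: "finite V \<Longrightarrow> V \<noteq> {} \<Longrightarrow> 0 < card (comps V F)"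
  by (simp add: comps_def card_gt_0_iff)

lemma comps_coarsen:
  assumes "F \<subseteq> G"
  shows "comps V G = (\<lambda>K. reach G `` K) ` comps V F"
proof -
  have "reach G `` (reach F `` {x}) = reach G `` {x}" for x
    using reach_mono[OF assms] by (auto intro: reach_trans)
  then show ?thesis by (simp add: comps_def image_image)
qed

text \<open>
  A new edge merges at most two classes: once the class of \<open>b\<close> is set aside, distinct old classes
  stay distinct.
\<close>

lemma card_comps_insert_ge:
  assumes "finite V"
  shows "card (comps V F) \<le> card (comps V (insert {a, b} F)) + 1"
proof -
  let ?G = "insert {a, b} F" and ?D = "comps V F - {reach F `` {b}}"
  have "inj_on (\<lambda>K. reach ?G `` K) ?D"
  proof (rule inj_onI)
    fix K L assume K: "K \<in> ?D" and L: "L \<in> ?D" and eq: "reach ?G `` K = reach ?G `` L"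
    from K obtain x where x: "K = reach F `` {x}" "(x, b) \<notin> reach F"
      using reach_class_eq_iff[of F] unfolding comps_def by blast
    from L obtain y where y: "L = reach F `` {y}" "(y, b) \<notin> reach F"
      using reach_class_eq_iff[of F] unfolding comps_def by blast
    have "y \<in> reach ?G `` K" unfolding eq y(1) by (intro ImageI[of y y]) auto
    then obtain z where "(x, z) \<in> reach F" "(z, y) \<in> reach ?G" using x by auto
    then have "(x, y) \<in> reach ?G" by (meson reach_mono reach_trans subsetD subset_insertI)
    then have "(x, y) \<in> reach F" using reach_insertD x(2) y(2) reach_sym by metis
    then show "K = L" using x(1) y(1) by (simp add: reach_class_eq_iff)
  qed
  then have "card ?D = card ((\<lambda>K. reach ?G `` K) ` ?D)" by (simp add: card_image)
  also have "\<dots> \<le> card (comps V ?G)"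
    unfolding comps_coarsen[OF subset_insertI[of F "{a, b}"]]
    by (rule card_mono) (auto simp: finite_comps assms)
  finally show ?thesis using card_Diff1_le[of "comps V F"] finite_comps[OF assms, of F]
    by (cases "reach F `` {b} \<in> comps V F") (auto simp: card_Diff_singleton)
qed

lemma card_comps_insert_less:
  assumes "finite V" "a \<in> V" "b \<in> V" "(a, b) \<notin> reach F"
  shows "card (comps V (insert {a, b} F)) < card (comps V F)"
proof -
  let ?G = "insert {a, b} F" and ?\<phi> = "\<lambda>K. reach (insert {a, b} F) `` K"
  let ?A = "reach F `` {a}" and ?B = "reach F `` {b}"
  have ab: "?A \<noteq> ?B" "?A \<in> comps V F" "?B \<in> comps V F"
    using assms by (auto simp: reach_class_eq_iff comps_def)
  have sub: "reach F \<subseteq> reach ?G" by (rule reach_mono) auto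
  have one: "reach ?G `` (reach F `` {x}) = reach ?G `` {x}" for x
    using sub by (auto intro: reach_trans)
  have merged: "?\<phi> ?A = ?\<phi> ?B"
    unfolding one reach_class_eq_iff by (rule reach_edge) simp
  have "comps V ?G \<subseteq> ?\<phi> ` (comps V F - {?B})"
  proof
    fix K assume "K \<in> comps V ?G"
    then obtain L where L: "L \<in> comps V F" "K = ?\<phi> L"
      unfolding comps_coarsen[OF subset_insertI[of F "{a, b}"]] by (rule imageE)
    show "K \<in> ?\<phi> ` (comps V F - {?B})"
    proof (cases "L = ?B")
      case True
      then show ?thesis using L(2) merged ab(1,2) by (intro image_eqI[of _ _ ?A]) simp_all
    next
      case False
      then show ?thesis using L by (intro image_eqI[of _ _ L]) simp_all
    qed
  qed
  then have "card (comps V ?G) \<le> card (comps V F - {?B})"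
    by (meson assms(1) card_image_le card_mono finite_Diff finite_comps finite_imageI le_trans)
  also have "\<dots> < card (comps V F)" using ab(3) finite_comps[OF assms(1)] by (rule card_Diff1_less[rotated])
  finally show ?thesis .
qed

lemma simple_edgeE:
  assumes "simple_graph V E" "e \<in> E"
  obtains x y where "e = {x, y}" "x \<noteq> y" "x \<in> V" "y \<in> V"
  using assms unfolding simple_graph_def card_2_iff by (metis insert_subset)

lemma simple_graph_finite: "simple_graph V E \<Longrightarrow> finite E"
  unfolding simple_graph_def by (rule finite_subset[of E "Pow V"]) auto

lemma simple_graph_mono: "simple_graph V E \<Longrightarrow> F \<subseteq> E \<Longrightarrow> simple_graph V F"
  unfolding simple_graph_def by blast

text \<open>
  Starting from isolated vertices, each edge lowers the number of components by at most one. For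
  forests the loss is exactly one per edge, which is why \<open>card_plus_comps_forest_le\<close> reverses the
  inequality. The two together replace rank computations in the packing argument.
\<close>

lemma card_plus_comps_ge:
  assumes "simple_graph V F"
  shows "card V \<le> card F + card (comps V F)"
  using simple_graph_finite[OF assms] assms
proof (induction F rule: finite_induct)
  case empty then show ?case by (simp add: card_comps_empty)
next
  case (insert e F)
  obtain a b where e: "e = {a, b}" by (rule simple_edgeE[OF insert.prems insertI1])
  have "finite V" using insert.prems by (simp add: simple_graph_def)
  then have "card (comps V F) \<le> card (comps V (insert e F)) + 1"
    unfolding e by (rule card_comps_insert_ge)
  moreover have "simple_graph V F" using insert.prems by (rule simple_graph_mono) auto
  ultimately show ?case using insert by simp
qed

section \<open>Forests\<close>

text \<open>Acyclicity is expressed as: every edge is a bridge.\<close>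

definition forest :: "'v set set \<Rightarrow> bool" where
  "forest F \<longleftrightarrow> (\<forall>a b. {a, b} \<in> F \<longrightarrow> (a, b) \<notin> reach (F - {{a, b}}))"

lemma forest_subset: "forest F \<Longrightarrow> G \<subseteq> F \<Longrightarrow> forest G"
  unfolding forest_def by (meson Diff_mono order_refl reach_mono subsetD)

lemma forest_insert:
  assumes "forest F" "(u, v) \<notin> reach F"
  shows "forest (insert {u, v} F)"
  unfolding forest_def
proof (intro allI impI notI)
  fix a b assume ab: "{a, b} \<in> insert {u, v} F" "(a, b) \<in> reach (insert {u, v} F - {{a, b}})"
  show False
  proof (cases "{a, b} = {u, v}")
    case True
    then have "(a, b) \<in> reach F" using ab(2) reach_mono[of "insert {u, v} F - {{a, b}}" F] by auto
    then show False using True assms(2) reach_sym[of a b F] by (auto simp: doubleton_eq_iff)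
  next
    case False
    let ?F = "F - {{a, b}}"
    have in_F: "{a, b} \<in> F" using ab(1) False by auto
    have "(a, b) \<in> reach (insert {u, v} ?F)" using ab(2) False by (simp add: insert_Diff_if)
    moreover have "(a, b) \<notin> reach ?F" using assms(1) in_F by (simp add: forest_def)
    ultimately have "(u, v) \<in> reach (insert {a, b} ?F)" by (rule reach_exchange)
    then show False using assms(2) in_F by (simp add: insert_absorb)
  qed
qed

lemma card_plus_comps_forest_le:
  assumes "simple_graph V F" "forest F"
  shows "card F + card (comps V F) \<le> card V"
  using simple_graph_finite[OF assms(1)] assms
proof (induction F rule: finite_induct)
  case empty then show ?case by (simp add: card_comps_empty)
next
  case (insert e F)
  obtain a b where e: "e = {a, b}" "a \<in> V" "b \<in> V"
    by (rule simple_edgeE[OF insert.prems(1) insertI1])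
  have "(a, b) \<notin> reach F"
    using insert.prems(2) insert.hyps(2) unfolding forest_def e(1)
    by (metis Diff_insert_absorb insertI1)
  moreover have "finite V" using insert.prems by (simp add: simple_graph_def)
  ultimately have "card (comps V (insert e F)) < card (comps V F)"
    unfolding e(1) using e(2,3) by (intro card_comps_insert_less)
  moreover have "simple_graph V F" "forest F"
    using insert.prems by (auto intro: simple_graph_mono forest_subset)
  ultimately show ?case using insert by simp
qed

text \<open>
  The minimal connecting set \<open>Q\<close> plays the role of the path between \<open>u\<close> and \<open>v\<close> in the
  forest, so \<open>g\<close> is an edge of the cycle that \<open>uv\<close> closes. If \<open>uv\<close> still closed a cycle after
  the removal of \<open>g\<close>, the ends of \<open>g\<close> would be connected without \<open>g\<close>.
\<close>

lemma forest_swap: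
  assumes "forest F" "Q \<subseteq> F" "(u, v) \<in> reach Q" "\<And>Q'. Q' \<subset> Q \<Longrightarrow> (u, v) \<notin> reach Q'" "g \<in> Q"
    "g = {a, b}"
  shows "forest (insert {u, v} (F - {g}))"
proof -
  have "(u, v) \<notin> reach (Q - {g})" using assms(4,5) by blast
  moreover have "(u, v) \<in> reach (insert {a, b} (Q - {g}))"
    using assms(3,5,6) by (simp add: insert_absorb)
  ultimately have "(a, b) \<in> reach (insert {u, v} (Q - {g}))" by (rule reach_exchange[rotated])
  then have ab: "(a, b) \<in> reach (insert {u, v} (F - {g}))"
    using assms(2) reach_mono[of "insert {u, v} (Q - {g})" "insert {u, v} (F - {g})"] by blast
  have "(a, b) \<notin> reach (F - {g})" using assms(1,2,5,6) unfolding forest_def by blast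
  then have "(u, v) \<notin> reach (F - {g})" using ab reach_insert_redundant by metis
  then show ?thesis using assms(1) by (blast intro: forest_insert forest_subset)
qed

section \<open>Packing connected spanning subgraphs\<close>

definition packing :: "'v set set \<Rightarrow> ('i \<Rightarrow> 'v set set) \<Rightarrow> bool" where
  "packing E F \<longleftrightarrow> (\<forall>i. F i \<subseteq> E \<and> forest (F i)) \<and> (\<forall>i j. i \<noteq> j \<longrightarrow> F i \<inter> F j = {})"

text \<open>
  Requiring a forest after every single step keeps maximality: each packing reached by such steps
  has the same total size as the first one. No shortest exchange sequences have to be chosen.
\<close>

definition swap :: "'v set set \<Rightarrow> (('i \<Rightarrow> 'v set set) \<times> ('i \<Rightarrow> 'v set set)) set" where
  "swap E = {(F, F'). \<exists>i e g. e \<in> E - (\<Union>j. F j) \<and> g \<in> F i \<and>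
                forest (insert e (F i - {g})) \<and> F' = F(i := insert e (F i - {g}))}"

lemma packing_swap:
  assumes "packing E F" "(F, F') \<in> swap E"
  shows "packing E F'"
  using assms unfolding packing_def swap_def by (auto split: if_splits) blast+

lemma size_swap:
  fixes F F' :: "'i::finite \<Rightarrow> 'v set set"
  assumes "finite E" "packing E F" "(F, F') \<in> swap E"
  shows "card (F' j) = card (F j)"
proof -
  obtain i e g where *: "e \<in> E - (\<Union>j. F j)" "g \<in> F i" "F' = F(i := insert e (F i - {g}))"
    using assms(3) by (auto simp: swap_def)
  have "finite (F i)" using assms(1,2) by (meson finite_subset packing_def)
  then have "card (insert e (F i - {g})) = Suc (card (F i - {g}))"
    using * by (subst card_insert_disjoint) auto
  also have "\<dots> = card (F i)" using \<open>finite (F i)\<close> *(2) by (rule card_Suc_Diff1)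
  finally show ?thesis using * by simp
qed

text \<open>
  The theorem of Nash-Williams and Tutte. The classes of a partition appear as the
  components of an edge set \<open>A\<close>; if \<open>A\<close> consists of all edges inside the classes, then
  \<open>E - A\<close> is the set of edges between them.

  The proof takes a packing \<open>F\<close> of largest total size and the set \<open>A\<close> of all edges that
  some sequence of exchanges leaves uncovered. Each forest, restricted to \<open>A\<close>, still has the
  same components as \<open>A\<close>, while all edges outside \<open>A\<close> are covered by \<open>F\<close>. Counting edges
  inside and outside \<open>A\<close> shows that \<open>F\<close> is large enough for each forest to be connected.
\<close>

theorem tree_packing:
  fixes V :: "'v set" and E :: "'v set set"
  assumes G: "simple_graph V E"
    and partition: "\<And>A. A \<subseteq> E \<Longrightarrow>
      CARD('i::finite) * card (comps V A) \<le> card (E - A) + CARD('i::finite)"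
  obtains F :: "'i::finite \<Rightarrow> 'v set set"
  where "packing E F" "\<And>i. card (comps V (F i)) = 1"
proof -
  define size where "size F = (\<Sum>i\<in>UNIV. card (F i))" for F :: "'i \<Rightarrow> 'v set set"
  have finE: "finite E" using G by (rule simple_graph_finite)
  have finV: "finite V" and neV: "V \<noteq> {}" using G by (auto simp: simple_graph_def)
  have "packing E (\<lambda>_::'i. {})" by (simp add: packing_def forest_def)
  moreover have "\<forall>F. packing E F \<longrightarrow> size F < Suc (CARD('i) * card E)"
  proof (intro allI impI)
    fix F :: "'i \<Rightarrow> 'v set set" assume "packing E F"
    then have "size F \<le> (\<Sum>i\<in>(UNIV::'i set). card E)"
      unfolding size_def by (intro sum_mono card_mono finE) (simp add: packing_def)
    then show "size F < Suc (CARD('i) * card E)" by simp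
  qed
  ultimately have "\<exists>F. packing E F \<and> (\<forall>F'. packing E F' \<longrightarrow> size F' \<le> size F)"
    by (rule ex_has_greatest_nat)
  then obtain F where F: "packing E F" and max: "\<And>F'. packing E F' \<Longrightarrow> size F' \<le> size F"
    by blast
  define A where "A = {e \<in> E. \<exists>F'. (F, F') \<in> (swap E)\<^sup>* \<and> e \<notin> (\<Union>i. F' i)}"
  have reachable: "packing E F' \<and> size F' = size F" if "(F, F') \<in> (swap E)\<^sup>*" for F'
    using that
  proof (induction rule: rtrancl_induct)
    case base then show ?case using F by simp
  next
    case (step H H')
    then have "packing E H" "size H = size F" by auto
    moreover have "size H' = size H"
      unfolding size_def using size_swap[OF finE \<open>packing E H\<close> step.hyps(2)] by simp
    ultimately show ?case using packing_swap[OF _ step.hyps(2)] by simp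
  qed
  \<comment> \<open>By maximality an uncovered edge closes a cycle in every forest; each edge of this cycle
      could be exchanged for it, and therefore lies in \<open>A\<close>.\<close>
  have key: "(u, v) \<in> reach (F' i \<inter> A)"
    if F': "(F, F') \<in> (swap E)\<^sup>*" and e: "{u, v} \<in> E - (\<Union>j. F' j)" for F' u v i
  proof -
    have pack: "packing E F'" and sz: "size F' = size F" using reachable[OF F'] by auto
    have fo: "forest (F' i)" and sub: "F' i \<subseteq> E" using pack by (auto simp: packing_def)
    have fin: "finite (F' i)" using sub finE by (rule finite_subset)
    have conn: "(u, v) \<in> reach (F' i)"
    proof (rule ccontr)
      assume "(u, v) \<notin> reach (F' i)"
      with fo have "forest (insert {u, v} (F' i))" by (rule forest_insert)
      then have "packing E (F'(i := insert {u, v} (F' i)))"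
        using pack e unfolding packing_def by auto
      then have "size (F'(i := insert {u, v} (F' i))) \<le> size F'" using max sz by simp
      moreover have "size F' < size (F'(i := insert {u, v} (F' i)))"
        unfolding size_def using e fin by (intro sum_strict_mono_ex1) (auto intro!: exI[of _ i])
      ultimately show False by simp
    qed
    then obtain Q where Q: "Q \<subseteq> F' i" "(u, v) \<in> reach Q"
      and Qmin: "\<And>Q'. Q' \<subset> Q \<Longrightarrow> (u, v) \<notin> reach Q'"
    proof -
      let ?S = "{Q. Q \<subseteq> F' i \<and> (u, v) \<in> reach Q}"
      have "finite ?S" using fin by simp
      moreover have "?S \<noteq> {}" using conn by blast
      ultimately obtain Q where "Q \<in> ?S" "\<forall>Q'\<in>?S. Q' \<subseteq> Q \<longrightarrow> Q = Q'"
        using finite_has_minimal[of ?S] by blast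
      then show ?thesis by (intro that[of Q]) auto
    qed
    have "Q \<subseteq> A"
    proof
      fix g assume g: "g \<in> Q"
      then have gi: "g \<in> F' i" and gE: "g \<in> E" using Q(1) sub by auto
      obtain a b where ab: "g = {a, b}" by (rule simple_edgeE[OF G gE])
      have "forest (insert {u, v} (F' i - {g}))"
        by (rule forest_swap[OF fo Q Qmin g ab])
      then have "(F', F'(i := insert {u, v} (F' i - {g}))) \<in> swap E"
        unfolding swap_def
        by (intro CollectI case_prodI exI[of _ i] exI[of _ "{u, v}"] exI[of _ g] conjI e gi refl)
      then have "(F, F'(i := insert {u, v} (F' i - {g}))) \<in> (swap E)\<^sup>*"
        using F' by (rule rtrancl_into_rtrancl[rotated])
      moreover have "g \<notin> (\<Union>j. (F'(i := insert {u, v} (F' i - {g}))) j)"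
      proof -
        have "g \<noteq> {u, v}" using gi e by blast
        moreover have "g \<notin> F' j" if "j \<noteq> i" for j
          using that gi pack unfolding packing_def by blast
        ultimately show ?thesis by auto
      qed
      ultimately show "g \<in> A" using gE unfolding A_def by blast
    qed
    then have "Q \<subseteq> F' i \<inter> A" using Q(1) by blast
    from reach_mono[OF this] Q(2) show ?thesis by blast
  qed
  \<comment> \<open>An exchange adds only an edge whose ends were already connected inside \<open>A\<close>, so
      connections inside \<open>A\<close> found after some exchanges existed in \<open>F\<close> itself.\<close>
  have pullback: "reach (F' i \<inter> A) \<subseteq> reach (F i \<inter> A)" if "(F, F') \<in> (swap E)\<^sup>*" for F' i
    using that
  proof (induction rule: rtrancl_induct)
    case base then show ?case by simp
  next
    case (step H H')
    from step.hyps(2) obtain j e g where e: "e \<in> E - (\<Union>j. H j)"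
      and H': "H' = H(j := insert e (H j - {g}))" by (auto simp: swap_def)
    have "reach (H' i \<inter> A) \<subseteq> reach (H i \<inter> A)"
    proof (cases "i = j")
      case True
      obtain u v where uv: "e = {u, v}" using e by (auto elim: simple_edgeE[OF G])
      have "reach (H' i \<inter> A) \<subseteq> reach (insert e (H i \<inter> A))"
        using True H' by (intro reach_mono) auto
      also have "\<dots> = reach (H i \<inter> A)"
        unfolding uv using key[OF step.hyps(1)] e uv by (intro reach_insert_redundant) blast
      finally show ?thesis .
    next
      case False
      then show ?thesis using H' by simp
    qed
    then show ?case using step.IH by blast
  qed
  have span: "reach (F i \<inter> A) = reach A" for i
  proof
    show "reach A \<subseteq> reach (F i \<inter> A)"
    proof (rule reach_subset)
      fix x y assume "{x, y} \<in> A"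
      then obtain F' where F': "(F, F') \<in> (swap E)\<^sup>*" and "{x, y} \<in> E - (\<Union>i. F' i)"
        unfolding A_def by blast
      then show "(x, y) \<in> reach (F i \<inter> A)" by (intro subsetD[OF pullback[OF F'] key[OF F']])
    qed
  qed (rule reach_mono, auto)
  have rest: "E - A \<subseteq> (\<Union>i. F i - A)" unfolding A_def by blast
  have Fi: "simple_graph V (F i)" "forest (F i)" "finite (F i)" for i
  proof -
    have sub: "F i \<subseteq> E" and "forest (F i)" using F by (auto simp: packing_def)
    then show "simple_graph V (F i)" "forest (F i)" "finite (F i)"
      using simple_graph_mono[OF G sub] finite_subset[OF sub finE] by auto
  qed
  have "card (E - A) \<le> (\<Sum>i\<in>UNIV. card (F i - A))"
  proof -
    have "card (E - A) \<le> card (\<Union>i. F i - A)" using rest Fi(3) by (intro card_mono) auto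
    also have "\<dots> \<le> (\<Sum>i\<in>UNIV. card (F i - A))" by (intro card_UN_le) simp
    finally show ?thesis .
  qed
  moreover have "CARD('i) * card V \<le> (\<Sum>i\<in>UNIV. card (F i \<inter> A)) + CARD('i) * card (comps V A)"
  proof -
    have "card V \<le> card (F i \<inter> A) + card (comps V A)" for i
    proof -
      have "comps V (F i \<inter> A) = comps V A" by (simp add: comps_def span)
      then show ?thesis
        using card_plus_comps_ge[OF simple_graph_mono[OF Fi(1)[of i], of "F i \<inter> A"]] by simp
    qed
    then have "(\<Sum>i\<in>(UNIV::'i set). card V) \<le> (\<Sum>i\<in>UNIV. card (F i \<inter> A) + card (comps V A))"
      by (intro sum_mono)
    then show ?thesis by (simp add: sum.distrib)
  qed
  moreover have "(\<Sum>i\<in>UNIV. card (F i)) = (\<Sum>i\<in>UNIV. card (F i \<inter> A)) + (\<Sum>i\<in>UNIV. card (F i - A))"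
    unfolding sum.distrib[symmetric] using Fi(3) by (intro sum.cong refl card_Int_Diff)
  moreover have "(\<Sum>i\<in>UNIV. card (F i)) + (\<Sum>i\<in>UNIV. card (comps V (F i))) \<le> CARD('i) * card V"
  proof -
    have "(\<Sum>i\<in>UNIV. card (F i) + card (comps V (F i))) \<le> (\<Sum>i\<in>(UNIV::'i set). card V)"
      using Fi by (intro sum_mono card_plus_comps_forest_le)
    then show ?thesis by (simp add: sum.distrib)
  qed
  moreover have "CARD('i) * card (comps V A) \<le> card (E - A) + CARD('i::finite)"
    by (rule partition) (auto simp: A_def)
  ultimately have le: "(\<Sum>i\<in>UNIV. card (comps V (F i))) \<le> (\<Sum>i\<in>(UNIV::'i set). 1)" by simp
  have pos: "1 \<le> card (comps V (F i))" for i using card_comps_pos[OF finV neV, of "F i"] by simp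
  have "card (comps V (F i)) = 1" for i
  proof (rule ccontr)
    assume "card (comps V (F i)) \<noteq> 1"
    then have "1 < card (comps V (F i))" using pos[of i] by simp
    then have "\<exists>i\<in>UNIV. 1 < card (comps V (F i))" by blast
    then have "(\<Sum>i\<in>(UNIV::'i set). 1) < (\<Sum>i\<in>UNIV. card (comps V (F i)))"
      using pos by (intro sum_strict_mono_ex1) auto
    then show False using le by simp
  qed
  with F show ?thesis by (rule that)
qed

lemma reach_if_one_comp:
  assumes "card (comps V F) = 1" "x \<in> V" "y \<in> V"
  shows "(x, y) \<in> reach F"
proof -
  obtain K where "comps V F = {K}" using assms(1) by (auto simp: card_1_singleton_iff)
  moreover have "reach F `` {x} \<in> comps V F" "reach F `` {y} \<in> comps V F"
    unfolding comps_def using assms(2,3) by (blast intro: imageI)+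
  ultimately have "reach F `` {x} = reach F `` {y}" by simp
  then show ?thesis by (simp add: reach_class_eq_iff)
qed

section \<open>Edge cuts\<close>

definition cut :: "'v set set \<Rightarrow> 'v set \<Rightarrow> 'v set set" where
  "cut E X = {e \<in> E. e \<inter> X \<noteq> {} \<and> \<not> e \<subseteq> X}"

text \<open>
  Double counting: each of the components has at least \<open>2 k\<close> edges leaving it, all of them outside
  \<open>A\<close>, and an edge leaves at most two components. With only one component the bound can fail,
  because the whole vertex set is not a proper side of a cut.
\<close>

lemma comps_le_cross_edges:
  assumes G: "simple_graph V E" and A: "A \<subseteq> E" and two: "2 \<le> card (comps V A)"
    and cuts: "\<And>X. X \<subset> V \<Longrightarrow> X \<noteq> {} \<Longrightarrow> 2 * k \<le> card (cut E X)"
  shows "k * card (comps V A) \<le> card (E - A)"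
proof -
  let ?C = "comps V A"
  have fin: "finite V" "finite E" "finite ?C"
    using G simple_graph_finite finite_comps by (auto simp: simple_graph_def)
  have big: "2 * k \<le> card {e \<in> E - A. e \<in> cut E K}" if K: "K \<in> ?C" for K
  proof -
    obtain x where x: "x \<in> V" "K = reach A `` {x}" using K by (auto simp: comps_def)
    have "K \<subseteq> V"
      unfolding x(2) using reach_closed[of x _ A V] x(1) A G by (auto simp: simple_graph_def)
    moreover have "K \<noteq> V"
    proof
      assume "K = V"
      then have "reach A `` {y} = K" if "y \<in> V" for y
      proof -
        have "(x, y) \<in> reach A" using that \<open>K = V\<close> x(2) by auto
        then show ?thesis unfolding x(2) using reach_class_eq_iff[of A x y] by simp
      qed
      then have "?C \<subseteq> {K}" by (auto simp: comps_def)
      then have "card ?C \<le> 1" using card_mono[of "{K}" ?C] by simp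
      then show False using two by simp
    qed
    moreover have "K \<noteq> {}"
    proof -
      have "x \<in> K" unfolding x(2) by (intro ImageI[of x x]) auto
      then show ?thesis by blast
    qed
    ultimately have "2 * k \<le> card (cut E K)" using cuts by blast
    moreover have "{e \<in> E - A. e \<in> cut E K} = cut E K"
    proof -
      have "e \<subseteq> K" if "e \<in> A" "e \<inter> K \<noteq> {}" for e
      proof -
        have "e \<in> E" using that(1) A by blast
        then obtain a b where "e = {a, b}" by (rule simple_edgeE[OF G])
        then have "(a, b) \<in> reach A" using that(1) by (simp add: reach_edge)
        then show ?thesis using that(2) reach_sym[of a b A] \<open>e = {a, b}\<close> unfolding x(2)
          by (auto intro: reach_trans)
      qed
      then show ?thesis by (auto simp: cut_def)
    qed
    ultimately show ?thesis by simp
  qed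
  have few: "card {K \<in> ?C. e \<in> cut E K} \<le> 2" if e: "e \<in> E - A" for e
  proof -
    obtain a b where ab: "e = {a, b}" using e by (auto elim: simple_edgeE[OF G])
    have "{K \<in> ?C. e \<in> cut E K} \<subseteq> {reach A `` {a}, reach A `` {b}}"
    proof
      fix K assume "K \<in> {K \<in> ?C. e \<in> cut E K}"
      then obtain x where "K = reach A `` {x}" "(x, a) \<in> reach A \<or> (x, b) \<in> reach A"
        unfolding comps_def cut_def ab by auto
      then show "K \<in> {reach A `` {a}, reach A `` {b}}"
        using reach_class_eq_iff[of A x a] reach_class_eq_iff[of A x b] by auto
    qed
    then have "card {K \<in> ?C. e \<in> cut E K} \<le> card {reach A `` {a}, reach A `` {b}}"
      by (rule card_mono[rotated]) simp
    also have "\<dots> \<le> 2" by (simp add: card_insert_if)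
    finally show ?thesis .
  qed
  have "card ?C * (2 * k) = (\<Sum>K\<in>?C. 2 * k)" by simp
  also have "\<dots> \<le> (\<Sum>K\<in>?C. card {e \<in> E - A. e \<in> cut E K})" by (rule sum_mono) (rule big)
  also have "\<dots> = (\<Sum>e\<in>E - A. card {K \<in> ?C. e \<in> cut E K})"
    using sum.swap_restrict[of ?C "E - A" "\<lambda>_ _. 1::nat" "\<lambda>K e. e \<in> cut E K"] fin by simp
  also have "\<dots> \<le> (\<Sum>e\<in>E - A. 2)" by (rule sum_mono) (rule few)
  finally show ?thesis by (simp add: mult.commute)
qed

lemma path_between_reach:
  assumes "path_between V E u p v"
  shows "(u, v) \<in> reach E"
proof -
  have "successively (\<lambda>x y. {x, y} \<in> E) p \<Longrightarrow> p \<noteq> [] \<Longrightarrow> (hd p, last p) \<in> reach E"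
  proof (induction p rule: induct_list012)
    case (3 x y zs)
    then have "(x, y) \<in> reach E" "(y, last (y # zs)) \<in> reach E" by (auto simp: reach_edge)
    then show ?case by (auto intro: reach_trans)
  qed auto
  then show ?thesis using assms by (auto simp: path_between_def)
qed

text \<open>
  A cut with fewer than \<open>k\<close> edges could be destroyed by deleting one end of each of its edges. For
  this to disconnect the graph a vertex must survive on each side; the two sides span at least
  \<open>card V - 1\<close> pairs, so some pair \<open>x\<close>, \<open>y\<close> across the cut is not an edge, and each
  cut edge then has an end different from both.
\<close>

lemma cut_ge_connectivity:
  assumes conn: "k_connected k V E" and large: "k < card V"
    and X: "X \<subset> V" "X \<noteq> {}"
  shows "k \<le> card (cut E X)"
proof (rule ccontr)
  assume "\<not> k \<le> card (cut E X)"
  then have small: "card (cut E X) < k" by simp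
  have G: "simple_graph V E" using conn by (simp add: k_connected_def)
  have finV: "finite V" using G by (simp add: simple_graph_def)
  have finX: "finite X" using X(1) finV by (meson finite_subset psubset_imp_subset)
  have fin: "finite (cut E X)" using simple_graph_finite[OF G] by (simp add: cut_def)
  let ?Y = "V - X"
  have "card V - 1 \<le> card (X \<times> ?Y)"
  proof -
    have total: "card X + card ?Y = card V"
      using card_Un_disjoint[OF finX, of ?Y] finV X(1) by (simp add: Un_absorb1 psubset_imp_subset)
    have "card X \<noteq> 0" using finX X by auto
    then obtain p where p: "card X = Suc p" by (rule not0_implies_Suc[THEN exE])
    have "card ?Y \<noteq> 0" using finV X by auto
    then obtain q where q: "card ?Y = Suc q" by (rule not0_implies_Suc[THEN exE])
    show ?thesis unfolding total[symmetric] card_cartesian_product p q by simp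
  qed
  then have many: "card (cut E X) < card (X \<times> ?Y)" using small large by simp
  have "\<exists>x\<in>X. \<exists>y\<in>?Y. {x, y} \<notin> cut E X"
  proof (rule ccontr)
    assume "\<not> ?thesis"
    then have "(\<lambda>(x, y). {x, y}) ` (X \<times> ?Y) \<subseteq> cut E X" by auto
    moreover have "inj_on (\<lambda>(x, y). {x, y}) (X \<times> ?Y)"
      by (auto simp: inj_on_def doubleton_eq_iff)
    ultimately have "card (X \<times> ?Y) \<le> card (cut E X)" using fin by (intro card_inj_on_le)
    then show False using many by simp
  qed
  then obtain x y where xy: "x \<in> X" "y \<in> ?Y" "{x, y} \<notin> cut E X" by blast
  have "\<exists>w. w \<in> e \<and> w \<noteq> x \<and> w \<noteq> y" if e: "e \<in> cut E X" for e
  proof -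
    have "e \<in> E" using e by (simp add: cut_def)
    then obtain a b where ab: "e = {a, b}" "a \<noteq> b" by (rule simple_edgeE[OF G])
    have "{a, b} \<noteq> {x, y}" using e xy(3) ab(1) by metis
    then have "a \<notin> {x, y} \<or> b \<notin> {x, y}" using ab(2) by (auto simp: doubleton_eq_iff)
    then show ?thesis unfolding ab(1) by blast
  qed
  then have "\<forall>e\<in>cut E X. \<exists>w. w \<in> e \<and> w \<noteq> x \<and> w \<noteq> y" by blast
  then obtain w where w: "\<forall>e\<in>cut E X. w e \<in> e \<and> w e \<noteq> x \<and> w e \<noteq> y"
    by (rule bchoice[THEN exE])
  define S where "S = w ` cut E X"
  have S: "S \<subseteq> V" "x \<notin> S" "y \<notin> S"
    using w G unfolding S_def cut_def simple_graph_def by blast+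
  have "card S < k" using small card_image_le[OF fin, of w] by (simp add: S_def)
  let ?F = "{e \<in> E. e \<subseteq> V - S}"
  have "x \<in> V - S" "y \<in> V - S" using S xy X by auto
  moreover have "all_joined (V - S) ?F"
    using conn S(1) \<open>card S < k\<close> by (simp add: k_connected_def)
  ultimately obtain p where "path_between (V - S) ?F x p y"
    unfolding all_joined_def by blast
  then have "(x, y) \<in> reach ?F" by (rule path_between_reach)
  then have "y \<in> X" using xy(1)
  proof (rule reach_closed)
    show "e \<subseteq> X" if "e \<in> ?F" "e \<inter> X \<noteq> {}" for e
      using that w by (auto simp: S_def cut_def)
  qed
  then show False using xy by simp
qed

section \<open>Levels and rising paths\<close>

lemma level_function:
  assumes "\<And>v. v \<in> V \<Longrightarrow> (v, r) \<in> reach T" "\<And>e. e \<in> T \<Longrightarrow> e \<subseteq> V"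
  shows "\<exists>d. d r = (0::nat) \<and>
           (\<forall>v\<in>V. v \<noteq> r \<longrightarrow> (\<exists>w\<in>V. {v, w} \<in> T \<and> d v = Suc (d w)))"
proof -
  define d where "d v = (LEAST n. (v, r) \<in> adj T ^^ n)" for v
  have d: "(v, r) \<in> adj T ^^ d v" if "v \<in> V" for v
  proof -
    have "\<exists>n. (v, r) \<in> adj T ^^ n"
      using assms(1)[OF that] by (simp add: reach_def rtrancl_power)
    then show ?thesis unfolding d_def by (rule LeastI_ex)
  qed
  have dle: "d v \<le> n" if "(v, r) \<in> adj T ^^ n" for v n
    unfolding d_def using that by (rule Least_le)
  show ?thesis
  proof (intro exI[of _ d] conjI ballI impI)
    show "d r = 0" using dle[of r 0] by simp
    fix v assume v: "v \<in> V" "v \<noteq> r"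
    obtain n where n: "d v = Suc n" using d[OF v(1)] v(2) by (cases "d v") auto
    then obtain w where w: "(v, w) \<in> adj T" "(w, r) \<in> adj T ^^ n"
      using d[OF v(1)] by (metis relpow_Suc_D2)
    then have wV: "w \<in> V" "{v, w} \<in> T" using assms(2) by (auto simp: adj_def)
    have "(v, r) \<in> adj T ^^ Suc (d w)" using w(1) d[OF wV(1)] by (rule relpow_Suc_I2)
    then have "d v \<le> Suc (d w)" by (rule dle)
    moreover have "d w \<le> n" using w(2) by (rule dle)
    ultimately show "\<exists>w\<in>V. {v, w} \<in> T \<and> d v = Suc (d w)" using n wV by auto
  qed
qed

lemma descending_path:
  fixes d :: "'v \<Rightarrow> nat"
  assumes "d r = 0" "v \<in> V"
    "\<And>v. v \<in> V \<Longrightarrow> v \<noteq> r \<Longrightarrow> \<exists>w\<in>V. {v, w} \<in> T \<and> d v = Suc (d w)"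
  shows "\<exists>p. p \<noteq> [] \<and> hd p = v \<and> last p = r \<and> set p \<subseteq> V \<and>
           successively (\<lambda>x y. {x, y} \<in> T \<and> d x = Suc (d y)) p"
  using assms(2)
proof (induction "d v" arbitrary: v rule: less_induct)
  case less
  show ?case
  proof (cases "v = r")
    case True
    then show ?thesis using less.prems by (intro exI[of _ "[v]"]) auto
  next
    case False
    then obtain w where w: "w \<in> V" "{v, w} \<in> T" "d v = Suc (d w)" using assms(3) less.prems by blast
    with less.hyps[of w] obtain p where p: "p \<noteq> []" "hd p = w" "last p = r" "set p \<subseteq> V"
      "successively (\<lambda>x y. {x, y} \<in> T \<and> d x = Suc (d y)) p" by auto
    then show ?thesis using w less.prems
      by (intro exI[of _ "v # p"]) (auto simp: successively_Cons)
  qed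
qed

text \<open>
  A path along which a level function increases by one at each step. Distance to the root is such a
  function for descents, and a constant minus that distance is one for climbs, so both halves
  of the path between two vertices are instances.
\<close>

abbreviation rising :: "'v set set \<Rightarrow> ('v \<Rightarrow> nat) \<Rightarrow> 'v list \<Rightarrow> bool" where
  "rising T l \<equiv> successively (\<lambda>x y. {x, y} \<in> T \<and> l y = Suc (l x))"

lemma rising_less: "rising T l (x # p) \<Longrightarrow> y \<in> set p \<Longrightarrow> l x < l y"
proof (induction p arbitrary: x)
  case (Cons z p)
  then show ?case by (cases "y = z") fastforce+
qed simp

lemma rising_distinct: "rising T l p \<Longrightarrow> distinct p"
proof (induction p)
  case (Cons x p)
  then show ?case using rising_less[of T l x p x] by (auto simp: successively_Cons)
qed simp

lemma rising_colors:
  assumes "rising T l p" "p \<noteq> []" "\<And>x. x \<in> set p \<Longrightarrow> l x \<le> length S"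
    "\<And>x y. {x, y} \<in> T \<Longrightarrow> l y = Suc (l x) \<Longrightarrow> f {x, y} = S ! l x"
  shows "map f (path_edges p) = take (length p - 1) (drop (l (hd p)) S)"
  using assms(1-3)
proof (induction p rule: induct_list012)
  case (3 x y zs)
  have "l y \<le> length S" using "3.prems"(3)[of y] by simp
  moreover have "l y = Suc (l x)" using "3.prems"(1) by simp
  ultimately have "drop (l x) S = S ! l x # drop (l y) S" using Cons_nth_drop_Suc[of "l x" S] by simp
  moreover have "f {x, y} = S ! l x" using 3 assms(4) by simp
  moreover have "map f (path_edges (y # zs)) = take (length zs) (drop (l y) S)" using 3 by simp
  ultimately show ?case by (simp add: path_edges_def)
qed (auto simp: path_edges_def)

lemma rising_colors_sublist:
  assumes "rising T l p" "p \<noteq> []" "\<And>x. x \<in> set p \<Longrightarrow> l x \<le> length S"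
    "\<And>x y. {x, y} \<in> T \<Longrightarrow> l y = Suc (l x) \<Longrightarrow> f {x, y} = S ! l x"
  shows "sublist (map f (path_edges p)) S"
proof -
  have "map f (path_edges p) = take (length p - 1) (drop (l (hd p)) S)"
    by (rule rising_colors) (fact assms)+
  then show ?thesis
    by (metis sublist_drop sublist_take sublist_order.order.trans)
qed

lemma path_edges_append:
  "path_edges (p @ x # q) = path_edges (p @ [x]) @ path_edges (x # q)"
  by (induction p rule: induct_list012) (auto simp: path_edges_def)

section \<open>Colorings for honest properties\<close>

lemma honest_block: "honest P \<Longrightarrow> P S \<Longrightarrow> sublist B S \<Longrightarrow> B \<noteq> [] \<Longrightarrow> P B"
  unfolding honest_def by blast

lemma honest_append:
  "honest P \<Longrightarrow> P S \<Longrightarrow> P T \<Longrightarrow> set S \<inter> set T = {} \<Longrightarrow> P (S @ T)"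
  unfolding honest_def by blast

lemma m_const_alphabet:
  assumes "honest P"
  obtains A where "finite A" "card A = m_const P" "arbitrarily_long_over P A"
proof -
  have "\<exists>k A. finite A \<and> card A = k \<and> arbitrarily_long_over P A"
    using assms unfolding honest_def by blast
  then have "\<exists>A. finite A \<and> card A = m_const P \<and> arbitrarily_long_over P A"
    unfolding m_const_def by (rule LeastI_ex)
  then show ?thesis using that by blast
qed

lemma P_c_le:
  assumes "connected_coloring P V E f" "finite B" "f ` E \<subseteq> B" "card B \<le> n"
  shows "P_c P V E \<le> enat n"
proof -
  have "P_c P V E \<le> enat (card (f ` E))"
    unfolding P_c_def using assms(1) by (intro INF_lower) simp
  also have "\<dots> \<le> enat n" using card_mono[OF assms(2,3)] assms(4) by simp
  finally show ?thesis .
qed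

lemma fresh_copy:
  fixes A :: "'c::infinite set"
  assumes "finite A"
  obtains g where "inj_on g A" "g ` A \<inter> A = {}"
proof -
  have "infinite (- A)" using assms infinite_UNIV by (simp add: Compl_eq_Diff_UNIV)
  then obtain B where B: "finite B" "card B = card A" "B \<subseteq> - A"
    using infinite_arbitrarily_large by blast
  then obtain g where "bij_betw g A B" using assms finite_same_card_bij by metis
  then have "inj_on g A" "g ` A \<inter> A = {}" using B by (auto simp: bij_betw_def)
  then show ?thesis by (rule that)
qed

text \<open>
  Shortest paths to a common root inside \<open>T1\<close> and \<open>T2\<close> are enough for the coloring by levels, so
  the two edge sets only have to connect all vertices. In particular they may be spanning trees.
\<close>

theorem coloring_from_two_connected_subgraphs:
  fixes P :: "'c::infinite list \<Rightarrow> bool"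
  assumes ren: "rename_invariant P" and hon: "honest P" and G: "simple_graph V E"
    and T: "T1 \<subseteq> E" "T2 \<subseteq> E" "T1 \<inter> T2 = {}"
    and conn: "\<And>x y. x \<in> V \<Longrightarrow> y \<in> V \<Longrightarrow> (x, y) \<in> reach T1"
      "\<And>x y. x \<in> V \<Longrightarrow> y \<in> V \<Longrightarrow> (x, y) \<in> reach T2"
  shows "P_c P V E \<le> enat (2 * m_const P)"
proof -
  obtain r where r: "r \<in> V" using G by (auto simp: simple_graph_def)
  have finV: "finite V" and sub: "\<And>e. e \<in> E \<Longrightarrow> e \<subseteq> V" using G by (auto simp: simple_graph_def)
  have sub1: "\<And>e. e \<in> T1 \<Longrightarrow> e \<subseteq> V" and sub2: "\<And>e. e \<in> T2 \<Longrightarrow> e \<subseteq> V"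
    using sub T by blast+
  have "\<exists>d. d r = 0 \<and> (\<forall>v\<in>V. v \<noteq> r \<longrightarrow> (\<exists>w\<in>V. {v, w} \<in> T1 \<and> d v = Suc (d w)))"
    by (rule level_function) (use conn(1) r sub1 in auto)
  then obtain d1 where d1: "d1 r = 0"
    "\<And>v. v \<in> V \<Longrightarrow> v \<noteq> r \<Longrightarrow> \<exists>w\<in>V. {v, w} \<in> T1 \<and> d1 v = Suc (d1 w)" by blast
  define N1 where "N1 = Max (d1 ` V)"
  have N1: "d1 v \<le> N1" if "v \<in> V" for v using that finV by (simp add: N1_def)
  have "\<exists>d. d r = 0 \<and> (\<forall>v\<in>V. v \<noteq> r \<longrightarrow> (\<exists>w\<in>V. {v, w} \<in> T2 \<and> d v = Suc (d w)))"
    by (rule level_function) (use conn(2) r sub2 in auto)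
  then obtain d2 where d2: "d2 r = 0"
    "\<And>v. v \<in> V \<Longrightarrow> v \<noteq> r \<Longrightarrow> \<exists>w\<in>V. {v, w} \<in> T2 \<and> d2 v = Suc (d2 w)" by blast
  define N2 where "N2 = Max (d2 ` V)"
  have N2: "d2 v \<le> N2" if "v \<in> V" for v using that finV by (simp add: N2_def)
  obtain A where A: "finite A" "card A = m_const P" "arbitrarily_long_over P A"
    using m_const_alphabet[OF hon] .
  \<comment> \<open>One letter more than the largest level, because an edge may join two vertices that both
      lie on that level.\<close>
  obtain S where S: "length S \<ge> Suc (max N1 N2)" "set S \<subseteq> A" "P S"
    using A(3) unfolding arbitrarily_long_over_def by blast
  obtain g where g: "inj_on g A" "g ` A \<inter> A = {}" using fresh_copy[OF A(1)] .
  define S' where "S' = map g S"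
  have PS': "P S'" unfolding S'_def
    using ren S g(1) unfolding rename_invariant_def by (meson inj_on_subset)
  \<comment> \<open>Levels in \<open>T1\<close> are counted towards the root, so that climbing reads \<open>S\<close> forwards.\<close>
  define l1 where "l1 v = N1 - d1 v" for v
  \<comment> \<open>The minimum is the level of the end that a rising path visits first. Edges outside both
      sets receive some letter of \<open>S\<close> and cost no further color.\<close>
  define f where "f e = (if e \<in> T2 then S' ! Min (d2 ` e) else S ! Min (l1 ` e))" for e
  have f1: "f {x, y} = S ! l1 x" if "{x, y} \<in> T1" "l1 y = Suc (l1 x)" for x y
  proof -
    have "{x, y} \<notin> T2" using that T(3) by blast
    then show ?thesis using that(2) by (simp add: f_def)
  qed
  have f2: "f {x, y} = S' ! d2 x" if "{x, y} \<in> T2" "d2 y = Suc (d2 x)" for x y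
    using that by (simp add: f_def)
  have image: "f ` E \<subseteq> A \<union> g ` A"
  proof
    fix c assume "c \<in> f ` E"
    then obtain e where e: "e \<in> E" "c = f e" by blast
    obtain x y where xy: "e = {x, y}" "x \<in> V" "y \<in> V" by (rule simple_edgeE[OF G e(1)])
    show "c \<in> A \<union> g ` A"
    proof (cases "e \<in> T2")
      case True
      have "Min (d2 ` e) < length S" using N2[OF xy(2)] S(1) xy(1) by auto
      then have "S' ! Min (d2 ` e) \<in> g ` A" using S(2) unfolding S'_def by (auto simp: subset_iff)
      then show ?thesis using True e(2) by (simp add: f_def)
    next
      case False
      have "Min (l1 ` e) < length S" using S(1) xy(1) by (auto simp: l1_def)
      then show ?thesis using False e(2) S(2) nth_mem by (auto simp: f_def)
    qed
  qed
  have "connected_coloring P V E f"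
    unfolding connected_coloring_def
  proof (intro ballI impI)
    fix u v assume uv: "u \<in> V" "v \<in> V" "u \<noteq> v"
    obtain p where p: "p \<noteq> []" "hd p = u" "last p = r" "set p \<subseteq> V"
      "successively (\<lambda>x y. {x, y} \<in> T1 \<and> d1 x = Suc (d1 y)) p"
      using descending_path[of d1 r u V T1] d1 uv by blast
    have up: "rising T1 l1 p"
      using p(5) by (rule successively_mono) (use p(4) N1 in \<open>fastforce simp: l1_def\<close>)
    obtain q' where q': "q' \<noteq> []" "hd q' = v" "last q' = r" "set q' \<subseteq> V"
      "successively (\<lambda>x y. {x, y} \<in> T2 \<and> d2 x = Suc (d2 y)) q'"
      using descending_path[of d2 r v V T2] d2 uv by blast
    define q where "q = rev q'"
    have q: "q \<noteq> []" "hd q = r" "last q = v" "set q \<subseteq> V"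
      using q' by (auto simp: q_def hd_rev last_rev)
    have down: "rising T2 d2 q"
      unfolding q_def successively_rev using q'(5)
      by (rule successively_mono) (auto simp: insert_commute)
    \<comment> \<open>Both \<open>p\<close> and \<open>q\<close> contain the root; leaving \<open>p\<close> at its first vertex on \<open>q\<close> makes the
        combined walk a path.\<close>
    have "\<exists>x\<in>set p. x \<in> set q" using p q by (metis hd_in_set last_in_set)
    then obtain p1 x p2 where x: "p = p1 @ x # p2" "x \<in> set q" "\<forall>z\<in>set p1. z \<notin> set q"
      using split_list_first_prop[of p "\<lambda>x. x \<in> set q"] by blast
    obtain q1 q2 where qs: "q = q1 @ x # q2" using x(2) by (meson split_list)
    have up': "rising T1 l1 (p1 @ [x])" using up unfolding x(1)
      by (auto simp: successively_append_iff)
    have down': "rising T2 d2 (x # q2)" using down unfolding qs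
      by (auto simp: successively_append_iff)
    have S1: "sublist (map f (path_edges (p1 @ [x]))) S"
      by (rule rising_colors_sublist[OF up'])
        (use S(1) f1 in \<open>auto simp: l1_def intro: le_trans\<close>)
    have S2: "sublist (map f (path_edges (x # q2))) S'"
    proof (rule rising_colors_sublist[OF down'])
      fix z assume "z \<in> set (x # q2)"
      then have "d2 z \<le> N2" using N2 q(4) qs by auto
      then show "d2 z \<le> length S'" using S(1) by (simp add: S'_def)
    qed (use f2 in auto)
    have path: "path_between V E u (p1 @ x # q2) v"
      unfolding path_between_def
    proof (intro conjI)
      show "hd (p1 @ x # q2) = u" using p(2) x(1) by (cases p1) auto
      show "last (p1 @ x # q2) = v" using q(3) qs by simp
      show "distinct (p1 @ x # q2)"
        using rising_distinct[OF up'] rising_distinct[OF down'] x(3) qs by auto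
      show "set (p1 @ x # q2) \<subseteq> V" using p(4) q(4) x(1) qs by auto
      have "successively (\<lambda>x y. {x, y} \<in> E) (p1 @ [x])"
        using up' by (rule successively_mono) (use T in auto)
      moreover have "successively (\<lambda>x y. {x, y} \<in> E) (x # q2)"
        using down' by (rule successively_mono) (use T in auto)
      ultimately show "successively (\<lambda>x y. {x, y} \<in> E) (p1 @ x # q2)"
        by (auto simp: successively_append_iff)
    qed simp
    have "P (map f (path_edges (p1 @ x # q2)))"
    proof (cases "p1 = [] \<or> q2 = []")
      \<comment> \<open>One half is a single vertex and contributes no color.\<close>
      case True
      have "p1 @ x # q2 \<noteq> [u]"
        using path uv(3) unfolding path_between_def by (metis last_ConsL)
      moreover have "p1 = [] \<Longrightarrow> x = u" using p(2) x(1) by simp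
      ultimately consider "p1 = []" "q2 \<noteq> []" | "q2 = []" "p1 \<noteq> []" using True by auto
      then show ?thesis
      proof cases
        case 1
        then have "path_edges (x # q2) \<noteq> []" by (cases q2) (auto simp: path_edges_def)
        then show ?thesis using honest_block[OF hon PS' S2] 1 by simp
      next
        case 2
        then have "path_edges (p1 @ [x]) \<noteq> []"
          by (cases p1; cases "tl p1") (auto simp: path_edges_def)
        then show ?thesis using honest_block[OF hon S(3) S1] 2 by simp
      qed
    next
      case False
      then have ne: "path_edges (p1 @ [x]) \<noteq> []" "path_edges (x # q2) \<noteq> []"
        by (cases p1; cases "tl p1"; cases q2; auto simp: path_edges_def)+
      have "P (map f (path_edges (p1 @ [x])))" "P (map f (path_edges (x # q2)))"
        using honest_block[OF hon S(3) S1] honest_block[OF hon PS' S2] ne by auto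
      moreover have "set (map f (path_edges (p1 @ [x]))) \<subseteq> A"
        using set_mono_sublist[OF S1] S(2) by blast
      moreover have "set (map f (path_edges (x # q2))) \<subseteq> g ` A"
        using set_mono_sublist[OF S2] S(2) unfolding S'_def by auto
      ultimately show ?thesis
        unfolding path_edges_append[of p1 x q2] map_append
        by (intro honest_append[OF hon]) (use g(2) in blast)+
    qed
    with path show "\<exists>p. path_between V E u p v \<and> P (map f (path_edges p))" by blast
  qed
  moreover have "card (A \<union> g ` A) \<le> 2 * m_const P"
    using card_Un_le[of A "g ` A"] card_image_le[OF A(1), of g] A(2) by simp
  ultimately show ?thesis using image A(1) by (intro P_c_le[of P V E f "A \<union> g ` A"]) auto
qed

section \<open>Complete and 4-connected graphs\<close>

lemma P_c_complete:
  assumes hon: "honest P" and complete: "\<And>u v. u \<in> V \<Longrightarrow> v \<in> V \<Longrightarrow> u \<noteq> v \<Longrightarrow> {u, v} \<in> E"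
  shows "P_c P V E \<le> enat (2 * m_const P)"
proof -
  obtain A where A: "finite A" "card A = m_const P" "arbitrarily_long_over P A"
    using m_const_alphabet[OF hon] .
  obtain S where S: "length S \<ge> 1" "set S \<subseteq> A" "P S"
    using A(3) unfolding arbitrarily_long_over_def by blast
  then obtain c S0 where cS: "S = c # S0" by (cases S) auto
  have "P [c]" by (rule honest_block[OF hon S(3)]) (auto simp: cS)
  have "connected_coloring P V E (\<lambda>_. c)"
    unfolding connected_coloring_def
  proof (intro ballI impI)
    fix u v assume "u \<in> V" "v \<in> V" "u \<noteq> v"
    then show "\<exists>p. path_between V E u p v \<and> P (map (\<lambda>_. c) (path_edges p))"
      using complete \<open>P [c]\<close>
      by (intro exI[of _ "[u, v]"]) (auto simp: path_between_def path_edges_def)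
  qed
  moreover have "1 \<le> card A" using A(1) S(2) cS by (auto simp: Suc_le_eq card_gt_0_iff)
  ultimately show ?thesis using A(2) by (intro P_c_le[of P V E "\<lambda>_. c" "{c}"]) auto
qed

text \<open>
  In a graph with so few vertices, all vertices but \<open>u\<close> and \<open>v\<close> may be deleted at once.
\<close>

lemma k_connected_small_complete:
  assumes "k_connected k V E" "card V < k + 2" "u \<in> V" "v \<in> V" "u \<noteq> v"
  shows "{u, v} \<in> E"
proof -
  have fin: "finite V" using assms(1) by (simp add: k_connected_def simple_graph_def)
  have "card (V - {u, v}) = card V - 2" using assms(3-5) by (simp add: card_Diff_subset)
  moreover have "2 \<le> card V" using card_mono[OF fin, of "{u, v}"] assms(3-5) by simp
  ultimately have "card (V - {u, v}) < k" using assms(2) by simp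
  moreover have "V - (V - {u, v}) = {u, v}" using assms by auto
  ultimately have "all_joined {u, v} {e \<in> E. e \<subseteq> {u, v}}"
    using assms(1) unfolding k_connected_def by (metis Diff_subset)
  then obtain p where "path_between {u, v} {e \<in> E. e \<subseteq> {u, v}} u p v"
    unfolding all_joined_def by blast
  then have uv: "(u, v) \<in> reach {e \<in> E. e \<subseteq> {u, v}}" by (rule path_between_reach)
  show ?thesis
  proof (rule ccontr)
    assume no: "{u, v} \<notin> E"
    have "e \<subseteq> {u}" if "e \<in> {e \<in> E. e \<subseteq> {u, v}}" "e \<inter> {u} \<noteq> {}" for e
    proof -
      have "e \<noteq> {u, v}" using that(1) no by blast
      then show ?thesis using that by blast
    qed
    then have "v \<in> {u}" using reach_closed[OF uv] by blast
    then show False using assms(5) by simp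
  qed
qed

lemma four_connected_packing:
  assumes conn: "k_connected 4 V E" and large: "4 < card V"
  obtains T1 T2 where "T1 \<subseteq> E" "T2 \<subseteq> E" "T1 \<inter> T2 = {}"
    "\<And>x y. x \<in> V \<Longrightarrow> y \<in> V \<Longrightarrow> (x, y) \<in> reach T1"
    "\<And>x y. x \<in> V \<Longrightarrow> y \<in> V \<Longrightarrow> (x, y) \<in> reach T2"
proof -
  have G: "simple_graph V E" using conn by (simp add: k_connected_def)
  have partition: "CARD(bool) * card (comps V A) \<le> card (E - A) + CARD(bool)" if "A \<subseteq> E" for A
  proof (cases "2 \<le> card (comps V A)")
    case True
    then show ?thesis
      using comps_le_cross_edges[OF G that, of 2] cut_ge_connectivity[OF conn large] by simp
  qed simp
  obtain F :: "bool \<Rightarrow> 'a set set" where F: "packing E F" "\<And>i. card (comps V (F i)) = 1"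
    using tree_packing[OF G partition] by metis
  show ?thesis
  proof (rule that)
    show "F True \<subseteq> E" "F False \<subseteq> E" using F(1) by (auto simp: packing_def)
    have "\<forall>i j. i \<noteq> j \<longrightarrow> F i \<inter> F j = {}" using F(1) by (simp add: packing_def)
    then show "F True \<inter> F False = {}" by (metis (full_types))
  qed (rule reach_if_one_comp[OF F(2)]; assumption)+
qed

theorem theorem12:
  fixes P :: "'c::infinite list \<Rightarrow> bool"
    and V :: "'v set" and E :: "'v set set"
  assumes "rename_invariant P"
    and "honest P"
    and "connected_graph V E"
  shows "((\<exists>T1 T2. spanning_tree V E T1 \<and> spanning_tree V E T2 \<and> T1 \<inter> T2 = {})
            \<longrightarrow> P_c P V E \<le> enat (2 * m_const P))
       \<and> (k_connected 4 V E \<longrightarrow> P_c P V E \<le> enat (2 * m_const P))"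
proof (intro conjI impI)
  have G: "simple_graph V E" using assms(3) by (simp add: connected_graph_def)
  note color = coloring_from_two_connected_subgraphs[OF assms(1,2) G]
  {
    assume "\<exists>T1 T2. spanning_tree V E T1 \<and> spanning_tree V E T2 \<and> T1 \<inter> T2 = {}"
    then obtain T1 T2 where T: "spanning_tree V E T1" "spanning_tree V E T2" "T1 \<inter> T2 = {}" by blast
    have "T \<subseteq> E \<and> (\<forall>x\<in>V. \<forall>y\<in>V. (x, y) \<in> reach T)" if "spanning_tree V E T" for T
      using that path_between_reach
      unfolding spanning_tree_def is_tree_def connected_graph_def all_joined_def by metis
    from this[OF T(1)] this[OF T(2)] show "P_c P V E \<le> enat (2 * m_const P)"
      by (intro color[OF _ _ T(3)]) auto
  next
    assume conn: "k_connected 4 V E"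
    show "P_c P V E \<le> enat (2 * m_const P)"
    proof (cases "4 < card V")
      case True
      show ?thesis by (rule four_connected_packing[OF conn True]) (rule color)
    next
      case False
      then show ?thesis
        using k_connected_small_complete[OF conn] by (intro P_c_complete assms(2)) auto
    qed
  }
qed

end
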